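(* Let $m\ge1$ and $u,v\in\mathcal{W}(B_{2m+1})$ with $u<v$ in Bruhat order and $v^{-1}(2m+1)<u^{-1}(2m+1)$ (as integers in $[\pm(2m+1)]$). Then $u\leqslant c(v)$.
   Context: For $k\ge1$, $B_k$ is the group of bijections $w$ of $[\pm k]=\{-k,\dots,-1,1,\dots,k\}$ with $w(-a)=-w(a)$; it is a Coxeter group with generators $(1,-1)$ and $(a,a+1)(-a,-a-1)$, $a\in[k-1]$; $\leqslant$ is Bruhat order. For $a\in[n]$ let $a^*=a-1$ if $a$ even, $a^*=a+1$ if $a$ odd and $a+1\le n$, $a^*=n$ otherwise; $\mathcal{W}(B_n)=\{v\in B_n: |v^{-1}(a)-v^{-1}(a^* )|\le1\ \forall a\in[n-1]\}$ (here $v^{-1}(a)\in[\pm n]$). For $v\in\mathcal{W}(B_{2m+1})$ let $j:=v^{-1}(2m+1)$ and define $c(v):=v\circ t\in\mathcal{W}(B_{2m+1})$ (composition of functions on $[\pm(2m+1)]$), where $t=(1,-1)$ if $j=-1$; $t=(j+1,j+2)(-j-1,-j-2)$ if $j\neq-1$ and $v(j+1)>v(j+2)$; and $t=(j,j+2)(-j,-j-2)$ if $j\neq-1$ and $v(j+1)<v(j+2)$. *)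

theory Defs
  imports Complex_Main "HOL-Combinatorics.Permutations"
begin

definition pm :: "nat \<Rightarrow> int set" where
  "pm k = {- int k..int k} - {0}"

text \<open>Signed permutations are extended to all integers by the identity outside \<^term>\<open>pm k\<close>
  (this is part of \<^term>\<open>w permutes A\<close>), so that the group operation is \<^term>\<open>(\<circ>)\<close> and
  group inverses are given by \<^term>\<open>inv\<close>.\<close>

definition B_group :: "nat \<Rightarrow> (int \<Rightarrow> int) set" where
  "B_group k = {w. w permutes pm k \<and> (\<forall>a\<in>pm k. w (- a) = - w a)}"

definition stransp :: "int \<Rightarrow> int \<Rightarrow> int \<Rightarrow> int" where
  "stransp a b = transpose a b \<circ> transpose (- a) (- b)"

definition B_gens :: "nat \<Rightarrow> (int \<Rightarrow> int) set" where
  "B_gens k = insert (transpose 1 (- 1)) {stransp a (a + 1) | a. a \<in> {1..int k - 1}}"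

definition B_length :: "nat \<Rightarrow> (int \<Rightarrow> int) \<Rightarrow> nat" where
  "B_length k w = (LEAST l. \<exists>ss. set ss \<subseteq> B_gens k \<and> length ss = l \<and> foldr (\<circ>) ss id = w)"

definition B_reflections :: "nat \<Rightarrow> (int \<Rightarrow> int) set" where
  "B_reflections k = {w \<circ> s \<circ> inv w | w s. w \<in> B_group k \<and> s \<in> B_gens k}"

definition bruhat_step :: "nat \<Rightarrow> (int \<Rightarrow> int) \<Rightarrow> (int \<Rightarrow> int) \<Rightarrow> bool" where
  "bruhat_step k u w \<longleftrightarrow> (\<exists>t\<in>B_reflections k. w = u \<circ> t \<and> B_length k u < B_length k w)"

definition bruhat_le :: "nat \<Rightarrow> (int \<Rightarrow> int) \<Rightarrow> (int \<Rightarrow> int) \<Rightarrow> bool" where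
  "bruhat_le k u w \<longleftrightarrow> u \<in> B_group k \<and> w \<in> B_group k \<and> (bruhat_step k)\<^sup>*\<^sup>* u w"

definition bruhat_less :: "nat \<Rightarrow> (int \<Rightarrow> int) \<Rightarrow> (int \<Rightarrow> int) \<Rightarrow> bool" where
  "bruhat_less k u w \<longleftrightarrow> bruhat_le k u w \<and> u \<noteq> w"

definition star :: "nat \<Rightarrow> int \<Rightarrow> int" where
  "star n a = (if even a then a - 1 else if a + 1 \<le> int n then a + 1 else int n)"

definition W_set :: "nat \<Rightarrow> (int \<Rightarrow> int) set" where
  "W_set n = {v \<in> B_group n. \<forall>a\<in>{1..int n - 1}. \<bar>inv v a - inv v (star n a)\<bar> \<le> 1}"

text \<open>Intended for odd \<^term>\<open>n\<close> and \<^term>\<open>v \<in> W_set n\<close>. Then \<^term>\<open>j\<close> is odd, so \<^term>\<open>j + 1\<close> and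
  \<^term>\<open>j + 2\<close> lie in \<^term>\<open>pm n\<close> unless \<^term>\<open>j = -1\<close> or \<^term>\<open>j = int n\<close>; in the last case
  the operation has no meaning and its value is irrelevant.\<close>

definition c_op :: "nat \<Rightarrow> (int \<Rightarrow> int) \<Rightarrow> int \<Rightarrow> int" where
  "c_op n v = (let j = inv v (int n) in
     v \<circ> (if j = - 1 then transpose 1 (- 1)
          else if v (j + 1) > v (j + 2) then stransp (j + 1) (j + 2)
          else stransp j (j + 2)))"

end

theory Submission
  imports Defs
begin

text \<open>Bruhat order on \<open>B_n\<close> is domination of the rank functions
  \<open>w[i, x] = #{a \<le> i. w a \<ge> x}\<close>. Passing from \<open>v\<close> to \<open>c v\<close> lowers \<open>v[i, x]\<close> by one on a
  rectangle and on its mirror image, so it suffices that \<open>u[i, x] < v[i, x]\<close> there. This is a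
  parity argument: if neither the cut after position \<open>i\<close> nor the threshold \<open>x\<close> separates a pair
  \<open>{a, a\<^sup>*}\<close>, then all pairs contribute even numbers to both ranks, whereas the unpaired value
  \<open>2m + 1\<close> is counted for \<open>v\<close> but not for \<open>u\<close>; hence the ranks differ. The remaining cuts
  and thresholds are reached from neighbouring ones of this kind.\<close>

section \<open>Signed permutations as odd bijections of the integers\<close>

lemma B_group_bij: "w \<in> B_group n \<Longrightarrow> bij w"
  unfolding B_group_def by (auto intro: permutes_bij)

lemma B_group_outside: "w \<in> B_group n \<Longrightarrow> a \<notin> pm n \<Longrightarrow> w a = a"
  unfolding B_group_def by (auto intro: permutes_not_in)

lemma B_group_minus: "w \<in> B_group n \<Longrightarrow> w (- a) = - w a"
proof -
  assume w: "w \<in> B_group n"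
  show ?thesis
  proof (cases "a \<in> pm n")
    case True
    then show ?thesis using w by (simp add: B_group_def)
  next
    case False
    then have "- a \<notin> pm n" by (auto simp: pm_def)
    then show ?thesis using B_group_outside[OF w] False by simp
  qed
qed

lemma B_group_zero: "w \<in> B_group n \<Longrightarrow> w 0 = 0"
  using B_group_minus[of w n 0] by simp

lemma B_group_in_pm: "w \<in> B_group n \<Longrightarrow> w a \<in> pm n \<longleftrightarrow> a \<in> pm n"
  unfolding B_group_def by (auto simp: permutes_in_image)

lemma B_group_inj: "w \<in> B_group n \<Longrightarrow> w a = w b \<longleftrightarrow> a = b"
  using B_group_bij by (metis bij_pointE)

lemma B_group_inv: "w \<in> B_group n \<Longrightarrow> w (inv w a) = a" "w \<in> B_group n \<Longrightarrow> inv w (w a) = a"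
  using B_group_bij by (simp_all add: bij_is_surj surj_f_inv_f bij_is_inj)

lemma B_groupI:
  assumes "bij w" "\<And>a. a \<notin> pm n \<Longrightarrow> w a = a" "\<And>a. w (- a) = - w a"
  shows "w \<in> B_group n"
  using assms unfolding B_group_def permutes_def by (auto simp: bij_iff)

lemma B_group_comp: "u \<in> B_group n \<Longrightarrow> w \<in> B_group n \<Longrightarrow> u \<circ> w \<in> B_group n"
  by (rule B_groupI)
    (auto simp: B_group_bij bij_comp B_group_minus B_group_outside)

lemma pm_iff: "a \<in> pm n \<longleftrightarrow> a \<noteq> 0 \<and> \<bar>a\<bar> \<le> int n"
  by (auto simp: pm_def)

lemma pm_minus: "- a \<in> pm n \<longleftrightarrow> a \<in> pm n"
  by (auto simp: pm_iff)

lemma finite_pm: "finite (pm n)"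
  by (simp add: pm_def)

section \<open>Reflections\<close>

text \<open>Unlike \<^const>\<open>stransp\<close>, which is the identity when \<^prop>\<open>b = - a\<close>, this is the
  reflection exchanging \<^term>\<open>a\<close> and \<^term>\<open>b\<close> in that case too.\<close>

definition brefl :: "int \<Rightarrow> int \<Rightarrow> int \<Rightarrow> int" where
  "brefl a b = (if a = - b then transpose a b else stransp a b)"

lemma brefl_apply: "brefl a b c =
  (if c = a then b else if c = b then a else if c = - a then - b else if c = - b then - a else c)"
  if "a \<noteq> 0" "b \<noteq> 0"
  using that by (auto simp: brefl_def stransp_def transpose_def)

lemma brefl_commute: "brefl a b = brefl b a"
  by (auto simp: brefl_def stransp_def transpose_commute)

lemma brefl_minus: "a \<noteq> 0 \<Longrightarrow> b \<noteq> 0 \<Longrightarrow> brefl (- b) (- a) = brefl a b"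
  by (rule ext) (auto simp: brefl_apply)

lemma brefl_brefl: "a \<noteq> 0 \<Longrightarrow> b \<noteq> 0 \<Longrightarrow> brefl a b \<circ> brefl a b = id"
  by (rule ext) (auto simp: brefl_apply)

lemma brefl_in_B_group:
  assumes "a \<in> pm n" "b \<in> pm n"
  shows "brefl a b \<in> B_group n"
proof (rule B_groupI)
  have nz: "a \<noteq> 0" "b \<noteq> 0" using assms by (auto simp: pm_iff)
  show "bij (brefl a b)" using brefl_brefl[OF nz] by (metis o_bij)
  show "brefl a b c = c" if "c \<notin> pm n" for c
    using that assms nz by (auto simp: brefl_apply pm_minus)
  show "brefl a b (- c) = - brefl a b c" for c
    using nz by (auto simp: brefl_apply)
qed

text \<open>Conjugation by \<open>w\<close> relabels a reflection: \<open>w\<close> is odd and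
  injective, so it carries the pairs exchanged by \<open>brefl a b\<close> to those exchanged by
  \<open>brefl (w a) (w b)\<close>.\<close>

lemma comp_brefl:
  assumes "w \<in> B_group n" "a \<in> pm n" "b \<in> pm n"
  shows "w \<circ> brefl a b = brefl (w a) (w b) \<circ> w"
proof
  fix c
  have nz: "a \<noteq> 0" "b \<noteq> 0" "w a \<noteq> 0" "w b \<noteq> 0"
    using assms B_group_in_pm[of w n] by (auto simp: pm_iff)
  show "(w \<circ> brefl a b) c = (brefl (w a) (w b) \<circ> w) c"
    using nz assms B_group_inj[OF assms(1)] B_group_minus[OF assms(1)]
    by (simp add: brefl_apply) (metis)
qed

section \<open>Simple reflections, words and exchange\<close>

text \<open>For positive \<open>n\<close>: the consecutive elements of \<open>pm n\<close>, one pair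
  from each orbit of \<open>(p, q)\<close> and \<open>(- q, - p)\<close>. With it both kinds of
  generators take the form \<open>brefl p q\<close>.\<close>

definition adjacent :: "nat \<Rightarrow> int \<Rightarrow> int \<Rightarrow> bool" where
  "adjacent n p q \<longleftrightarrow> (p = - 1 \<and> q = 1) \<or> (1 \<le> p \<and> p < int n \<and> q = p + 1)"

lemma adjacent_pm: "n \<ge> 1 \<Longrightarrow> adjacent n p q \<Longrightarrow> p \<in> pm n \<and> q \<in> pm n \<and> p < q"
  by (auto simp: adjacent_def pm_iff)

lemma B_gens_iff: "s \<in> B_gens n \<longleftrightarrow> (\<exists>p q. adjacent n p q \<and> s = brefl p q)"
proof -
  have "stransp a (a + 1) = brefl a (a + 1)" if "a \<ge> 1" for a
    using that by (auto simp: brefl_def)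
  moreover have "transpose 1 (- 1) = brefl (- 1) 1"
    by (simp add: brefl_def transpose_commute)
  ultimately show ?thesis
    by (auto simp: B_gens_def adjacent_def)
qed

text \<open>No nonzero integer lies between \<open>p\<close> and \<open>q\<close>, so exchanging
  them reverses the order of \<open>(p, q)\<close> and of its mirror \<open>(- q, - p)\<close> only,
  and both give the same reflection.\<close>

lemma brefl_inverts_adjacent:
  assumes "adjacent n p q" "a < b" "a \<noteq> 0" "b \<noteq> 0" "brefl p q b < brefl p q a"
  shows "brefl a b = brefl p q"
proof -
  have nz: "p \<noteq> 0" "q \<noteq> 0" using assms(1) by (auto simp: adjacent_def)
  have "(a = p \<and> b = q) \<or> (a = - q \<and> b = - p)"
    using assms(1) unfolding adjacent_def
  proof (elim disjE conjE)
    assume "p = - 1" "q = 1"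
    then show ?thesis using assms(2-5) unfolding brefl_apply[OF nz] by (simp split: if_splits)
  next
    assume p: "1 \<le> p" and q: "q = p + 1"
    show ?thesis
      using assms(2-5) p nz unfolding brefl_apply[OF nz] unfolding q
      by (smt (verit))
  qed
  then show ?thesis using brefl_minus nz by auto
qed

lemma word_Cons: "foldr (\<circ>) (s # ss) id = s \<circ> foldr (\<circ>) ss id"
  by (simp only: foldr.simps comp_apply)

lemma word_in_B_group:
  "n \<ge> 1 \<Longrightarrow> set ss \<subseteq> B_gens n \<Longrightarrow> foldr (\<circ>) ss id \<in> B_group n"
proof (induction ss)
  case Nil
  have "id \<in> B_group n" by (rule B_groupI) (simp_all add: bij_id)
  then show ?case by (simp add: id_def)
next
  case (Cons s ss)
  then have "s \<in> B_group n"
    using adjacent_pm brefl_in_B_group by (auto simp: B_gens_iff)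
  moreover have "foldr (\<circ>) ss id \<in> B_group n"
    using Cons.IH Cons.prems by (meson set_subset_Cons subset_trans)
  ultimately show ?case unfolding word_Cons by (rule B_group_comp)
qed

text \<open>Strong exchange: the letter of the word that inverts the pair \<open>(a, b)\<close> can be deleted.\<close>

lemma word_exchange:
  assumes "n \<ge> 1" "set ss \<subseteq> B_gens n" "a \<in> pm n" "b \<in> pm n" "a < b"
    "foldr (\<circ>) ss id b < foldr (\<circ>) ss id a"
  shows "\<exists>ss'. set ss' \<subseteq> B_gens n \<and> length ss' < length ss \<and>
    foldr (\<circ>) ss' id = foldr (\<circ>) ss id \<circ> brefl a b"
  using assms(2,6)
proof (induction ss)
  case Nil
  then show ?case using assms by simp
next
  case (Cons s ss)
  let ?w = "foldr (\<circ>) ss id"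
  have w: "?w \<in> B_group n" using word_in_B_group assms(1) Cons by simp
  show ?case
  proof (cases "?w b < ?w a")
    case True
    then obtain ss' where "set ss' \<subseteq> B_gens n" "length ss' < length ss"
      "foldr (\<circ>) ss' id = ?w \<circ> brefl a b"
      using Cons.IH Cons.prems(1) by (meson set_subset_Cons subset_trans)
    then show ?thesis unfolding word_Cons using Cons.prems(1)
      by (intro exI[of _ "s # ss'"]) (simp only: word_Cons comp_assoc, simp)
  next
    case False
    then have less: "?w a < ?w b" using B_group_inj[OF w, of a b] assms by auto
    obtain p q where s: "adjacent n p q" "s = brefl p q"
      using Cons.prems by (auto simp: B_gens_iff)
    have nz: "?w a \<noteq> 0" "?w b \<noteq> 0"
      using B_group_in_pm[OF w] assms by (auto simp: pm_iff)
    \<comment> \<open>The letter \<open>s\<close> turns the ascent \<open>?w a < ?w b\<close> into a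
      descent, hence exchanges exactly these two values; moved to the right of \<open>?w\<close> it
      becomes \<open>brefl a b\<close> and cancels.\<close>
    have "s = brefl (?w a) (?w b)"
      using brefl_inverts_adjacent[OF s(1) less nz] s(2) Cons.prems(2)
      unfolding word_Cons by simp
    then have "s \<circ> (?w \<circ> brefl a b) = ?w"
      using comp_brefl[OF w assms(3,4)] brefl_brefl[OF nz] by (metis comp_assoc id_comp)
    then show ?thesis unfolding word_Cons comp_assoc using Cons.prems(1)
      by (intro exI[of _ ss]) (simp del: o_apply id_apply)
  qed
qed

section \<open>Rank functions\<close>

definition rk :: "nat \<Rightarrow> (int \<Rightarrow> int) \<Rightarrow> int \<Rightarrow> int \<Rightarrow> int" where
  "rk n w i x = (\<Sum>a\<in>pm n. of_bool (a \<le> i \<and> x \<le> w a))"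

lemma rk_nonneg: "rk n w i x \<ge> 0"
  unfolding rk_def by (rule sum_nonneg) simp

lemma rk_mono_row: "i \<le> i' \<Longrightarrow> rk n w i x \<le> rk n w i' x"
  unfolding rk_def by (rule sum_mono) auto

text \<open>Serves to step across 0, which is not a position: the rows -1 and 0 coincide.\<close>

lemma rk_row_gap:
  assumes "i \<le> i'" "\<And>a. a \<in> pm n \<Longrightarrow> i < a \<Longrightarrow> i' < a"
  shows "rk n w i' x = rk n w i x"
  unfolding rk_def using assms by (intro sum.cong) force+

lemma rk_row:
  assumes "i \<in> pm n"
  shows "rk n w i x = rk n w (i - 1) x + of_bool (x \<le> w i)"
proof -
  have "(\<Sum>a\<in>pm n - {i}. of_bool (a \<le> i \<and> x \<le> w a)) =
    (\<Sum>a\<in>pm n - {i}. of_bool (a \<le> i - 1 \<and> x \<le> w a) :: int)"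
    by (rule sum.cong) auto
  then show ?thesis
    unfolding rk_def sum.remove[OF finite_pm assms] by simp
qed

lemma rk_column:
  assumes "w \<in> B_group n"
  shows "rk n w i x = rk n w i (x + 1) + of_bool (x \<in> pm n \<and> inv w x \<le> i)"
proof -
  have eq: "of_bool (a \<le> i \<and> x \<le> w a) = of_bool (a \<le> i \<and> x + 1 \<le> w a) +
      (if a = inv w x then of_bool (inv w x \<le> i) else (0::int))" for a
    using B_group_inv[OF assms, of x] B_group_inv[OF assms, of a]
    by (cases "w a = x") (auto simp: order.order_iff_strict)
  have "rk n w i x = rk n w i (x + 1) + of_bool (inv w x \<in> pm n \<and> inv w x \<le> i)"
    unfolding rk_def eq sum.distrib by (simp add: finite_pm)
  moreover have "inv w x \<in> pm n \<longleftrightarrow> x \<in> pm n"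
    using B_group_in_pm[OF assms, of "inv w x"] B_group_inv[OF assms] by simp
  ultimately show ?thesis by simp
qed

text \<open>Only the positions \<open>p\<close> and \<open>q\<close> matter. The larger value moves
  from \<open>p\<close> to \<open>q\<close>, so one entry is lost exactly for cuts between the
  positions and thresholds between the values.\<close>

lemma rk_comp_transpose:
  assumes "p \<in> pm n" "q \<in> pm n" "p < q" "w q < w p"
  shows "rk n (w \<circ> transpose p q) i x =
    rk n w i x - of_bool (p \<le> i \<and> i < q \<and> w q < x \<and> x \<le> w p)"
proof -
  have split: "rk n f i x = of_bool (p \<le> i \<and> x \<le> f p) + of_bool (q \<le> i \<and> x \<le> f q) +
    (\<Sum>a\<in>pm n - {p} - {q}. of_bool (a \<le> i \<and> x \<le> f a))" for f
    unfolding rk_def using assms finite_pm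
    by (subst sum.remove[of _ p], simp, simp, subst sum.remove[of _ q]) auto
  have "(\<Sum>a\<in>pm n - {p} - {q}. of_bool (a \<le> i \<and> x \<le> (w \<circ> transpose p q) a)) =
    (\<Sum>a\<in>pm n - {p} - {q}. of_bool (a \<le> i \<and> x \<le> w a) :: int)"
    by (rule sum.cong) (auto simp: transpose_def)
  then show ?thesis
    unfolding split using assms by auto
qed

text \<open>For \<open>p \<noteq> - q\<close> the reflection is a product of two disjoint
  transpositions; the second one costs the mirror image of the first rectangle.\<close>

lemma rk_comp_brefl:
  assumes "w \<in> B_group n" "p \<in> pm n" "q \<in> pm n" "p < q" "w q < w p"
  shows "rk n (w \<circ> brefl p q) i x = rk n w i x
    - of_bool (p \<le> i \<and> i < q \<and> w q < x \<and> x \<le> w p)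
    - of_bool (p \<noteq> - q \<and> - q \<le> i \<and> i < - p \<and> - w p < x \<and> x \<le> - w q)"
proof (cases "p = - q")
  case True
  then show ?thesis using rk_comp_transpose[OF assms(2-5)] by (simp add: brefl_def)
next
  case False
  let ?v = "w \<circ> transpose p q"
  have v: "?v (- p) = - w p" "?v (- q) = - w q"
    using False assms B_group_minus[OF assms(1)] by (auto simp: transpose_def pm_iff)
  have "w \<circ> brefl p q = ?v \<circ> transpose (- q) (- p)"
    using False by (simp add: brefl_def stransp_def comp_assoc transpose_commute)
  then show ?thesis
    using rk_comp_transpose[of "- q" n "- p" ?v i x] rk_comp_transpose[OF assms(2-5), of i x]
      v assms False by (simp add: pm_minus)
qed

section \<open>Descents, words and length\<close>

text \<open>The pair \<open>(-1, 1)\<close> makes \<open>w 1\<close> positive; increasing from there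
  gives \<open>w k \<ge> k\<close>, and decreasing from \<open>w n \<le> n\<close> gives
  \<open>w k \<le> k\<close>. Oddness settles the negative positions.\<close>

lemma no_descent_id:
  assumes "w \<in> B_group n" "\<And>p q. adjacent n p q \<Longrightarrow> w p < w q"
  shows "w = id"
proof -
  have pos: "w 1 > 0" using assms(2)[of "- 1" 1] B_group_minus[OF assms(1), of 1]
    by (simp add: adjacent_def)
  have inc: "w (int k) < w (int k + 1)" if "1 \<le> k" "k < n" for k
    using that assms(2)[of "int k" "int k + 1"] by (simp add: adjacent_def)
  have lower: "w (int k) \<ge> int k" if "k \<le> n" for k
    using that
  proof (induction k)
    case (Suc k)
    then show ?case using pos inc[of k] by (cases "k = 0") (auto simp: add.commute)
  qed (simp add: B_group_zero[OF assms(1)])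
  have upper: "w (int (n - k)) \<le> int (n - k)" if "k < n" for k
    using that
  proof (induction k)
    case 0
    then show ?case using B_group_in_pm[OF assms(1), of "int n"] by (auto simp: pm_iff)
  next
    case (Suc k)
    have "int (n - Suc k) + 1 = int (n - k)" using Suc by simp
    then show ?case using Suc inc[of "n - Suc k"] by fastforce
  qed
  have nat: "w (int k) = int k" if "k \<le> n" for k
    using that lower[of k] upper[of "n - k"] B_group_zero[OF assms(1)] by (cases "k = 0") auto
  show ?thesis
  proof
    fix a
    show "w a = id a"
    proof (cases "a \<in> pm n")
      case True
      then show ?thesis using nat[of "nat \<bar>a\<bar>"] B_group_minus[OF assms(1), of a]
        by (auto simp: pm_iff abs_if split: if_splits)
    next
      case False
      then show ?thesis using B_group_outside[OF assms(1)] by simp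
    qed
  qed
qed

lemma B_group_descent_cases:
  assumes "w \<in> B_group n" "n \<ge> 1"
  obtains "w = id" | p q where "adjacent n p q" "w q < w p"
proof -
  have "w p < w q \<or> w q < w p" if "adjacent n p q" for p q
    using that B_group_inj[OF assms(1), of p q] adjacent_pm[OF assms(2)] by force
  then show ?thesis using no_descent_id[OF assms(1)] that by blast
qed

text \<open>An induction measure that drops whenever an inversion is undone; unlike
  \<open>B_length\<close> it does not presuppose that the generators generate.\<close>

definition rk_sum :: "nat \<Rightarrow> (int \<Rightarrow> int) \<Rightarrow> nat" where
  "rk_sum n w = nat (\<Sum>i\<in>{- int n..int n}. \<Sum>x\<in>{- int n..int n}. rk n w i x)"

lemma rk_sum_descent:
  assumes "w \<in> B_group n" "p \<in> pm n" "q \<in> pm n" "p < q" "w q < w p"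
  shows "rk_sum n (w \<circ> brefl p q) < rk_sum n w"
proof -
  let ?I = "{- int n..int n}"
  let ?S = "\<lambda>w. \<Sum>i\<in>?I. \<Sum>x\<in>?I. rk n w i x"
  have le: "rk n (w \<circ> brefl p q) i x \<le> rk n w i x" for i x
    using rk_comp_brefl[OF assms] by simp
  \<comment> \<open>The point \<open>(p, w p)\<close> is a corner of the lost rectangle.\<close>
  have less: "rk n (w \<circ> brefl p q) p (w p) < rk n w p (w p)"
    using rk_comp_brefl[OF assms, of p "w p"] assms by simp
  have "w p \<in> pm n" using B_group_in_pm assms by auto
  then have p: "p \<in> ?I" "w p \<in> ?I" using assms by (auto simp: pm_iff)
  have "(\<Sum>x\<in>?I. rk n (w \<circ> brefl p q) p x) < (\<Sum>x\<in>?I. rk n w p x)"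
    by (rule sum_strict_mono_ex1) (use le less p in auto)
  then have "?S (w \<circ> brefl p q) < ?S w"
    by (intro sum_strict_mono_ex1) (use le p in \<open>auto intro: sum_mono\<close>)
  moreover have "?S (w \<circ> brefl p q) \<ge> 0" by (intro sum_nonneg rk_nonneg)
  ultimately show ?thesis unfolding rk_sum_def by linarith
qed

text \<open>Descents are undone until the identity remains. This ensures that the
  \<open>LEAST\<close> in \<open>B_length\<close> is attained.\<close>

lemma B_group_word:
  assumes "n \<ge> 1" "w \<in> B_group n"
  shows "\<exists>ss. set ss \<subseteq> B_gens n \<and> foldr (\<circ>) ss id = w"
  using assms(2)
proof (induction "rk_sum n w" arbitrary: w rule: less_induct)
  case less
  from less.prems assms(1) show ?case
  proof (cases rule: B_group_descent_cases)
    case 1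
    then show ?thesis by (intro exI[of _ "[]"]) auto
  next
    case (2 p q)
    then have pq: "p \<in> pm n" "q \<in> pm n" "p < q" using adjacent_pm assms(1) by auto
    obtain ss where ss: "set ss \<subseteq> B_gens n" "foldr (\<circ>) ss id = w \<circ> brefl p q"
      using less.hyps[OF rk_sum_descent[OF less.prems pq 2(2)]]
        B_group_comp less.prems brefl_in_B_group pq by blast
    have "foldr (\<circ>) (ss @ [brefl p q]) id = foldr (\<circ>) ss id \<circ> brefl p q"
      by (induction ss) (auto simp: comp_assoc)
    also have "\<dots> = w" unfolding ss
      using brefl_brefl[of p q] pq by (simp add: comp_assoc pm_iff)
    finally show ?thesis using ss 2
      by (intro exI[of _ "ss @ [brefl p q]"]) (auto simp: B_gens_iff)
  qed
qed

text \<open>Strong exchange applied to a shortest word.\<close>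

lemma B_length_descent:
  assumes "n \<ge> 1" "w \<in> B_group n" "a \<in> pm n" "b \<in> pm n" "a < b" "w b < w a"
  shows "B_length n (w \<circ> brefl a b) < B_length n w"
proof -
  let ?P = "\<lambda>w l. \<exists>ss. set ss \<subseteq> B_gens n \<and> length ss = l \<and> foldr (\<circ>) ss id = w"
  have "\<exists>l. ?P w l" using B_group_word[OF assms(1,2)] by auto
  then have "?P w (B_length n w)"
    unfolding B_length_def by (rule LeastI_ex)
  then obtain ss where ss: "set ss \<subseteq> B_gens n" "length ss = B_length n w" "foldr (\<circ>) ss id = w"
    by auto
  obtain ss' where ss': "set ss' \<subseteq> B_gens n" "length ss' < length ss"
    "foldr (\<circ>) ss' id = w \<circ> brefl a b"
    using word_exchange[OF assms(1) ss(1) assms(3,4,5)] ss(3) assms(6) by auto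
  have "B_length n (w \<circ> brefl a b) \<le> length ss'"
    unfolding B_length_def by (rule Least_le) (use ss' in auto)
  then show ?thesis using ss ss' by simp
qed

section \<open>Reflections and Bruhat steps\<close>

lemma B_reflections_iff:
  assumes "n \<ge> 1"
  shows "t \<in> B_reflections n \<longleftrightarrow> (\<exists>a\<in>pm n. \<exists>b\<in>pm n. a < b \<and> t = brefl a b)"
proof
  assume "t \<in> B_reflections n"
  then obtain w p q where w: "w \<in> B_group n" "adjacent n p q" "t = w \<circ> brefl p q \<circ> inv w"
    by (auto simp: B_reflections_def B_gens_iff)
  have pq: "p \<in> pm n" "q \<in> pm n" "p < q" using adjacent_pm assms w by auto
  have "t = brefl (w p) (w q)"
    unfolding w(3) comp_brefl[OF w(1) pq(1,2)] using B_group_inv[OF w(1)] by auto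
  moreover have "w p \<noteq> w q" using B_group_inj[OF w(1)] pq by simp
  moreover have "w p \<in> pm n" "w q \<in> pm n" using B_group_in_pm[OF w(1)] pq by auto
  ultimately show "\<exists>a\<in>pm n. \<exists>b\<in>pm n. a < b \<and> t = brefl a b"
    using brefl_commute by (metis linorder_neqE)
next
  assume "\<exists>a\<in>pm n. \<exists>b\<in>pm n. a < b \<and> t = brefl a b"
  then obtain a b where ab: "a \<in> pm n" "b \<in> pm n" "a < b" "t = brefl a b" by auto
  have "\<exists>w p q. w \<in> B_group n \<and> adjacent n p q \<and> (w p = a \<and> w q = b \<or> w p = b \<and> w q = a)"
  proof -
    \<comment> \<open>A conjugating element is built in two stages: \<open>g\<close> sends 1 to
      \<open>b\<close>, which suffices for \<open>a = - b\<close> with the pair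
      \<open>(-1, 1)\<close>.\<close>
    define g where "g = brefl 1 b"
    have one: "1 \<in> pm n" using assms by (auto simp: pm_iff)
    have g: "g \<in> B_group n" unfolding g_def using brefl_in_B_group one ab by blast
    have g1: "g 1 = b" using ab by (simp add: g_def brefl_apply pm_iff)
    show ?thesis
    proof (cases "a = - b")
      case True
      then show ?thesis using g g1 B_group_minus[OF g, of 1]
        by (intro exI[of _ g] exI[of _ "- 1"] exI[of _ 1]) (simp add: adjacent_def)
    next
      case False
      have n2: "n \<ge> 2" using False ab by (auto simp: pm_iff)
      then have two: "2 \<in> pm n" by (auto simp: pm_iff)
      have g2: "g 2 \<in> pm n" using B_group_in_pm[OF g] two by simp
      have g2b: "g 2 \<noteq> b" "g 2 \<noteq> - b"
        using g1 B_group_inj[OF g, of 2 1] B_group_inj[OF g, of 2 "- 1"] B_group_minus[OF g, of 1] by auto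
      \<comment> \<open>The image of 2 is corrected to \<open>a\<close>; the value \<open>b\<close>
        at 1 survives, being different from \<open>g 2\<close>, \<open>a\<close> and their
        negatives.\<close>
      define h where "h = brefl (g 2) a \<circ> g"
      have h: "h \<in> B_group n"
        unfolding h_def using B_group_comp brefl_in_B_group g g2 ab by blast
      have "h 1 = b" "h 2 = a"
        unfolding h_def using g1 g2b g2 ab False by (auto simp: brefl_apply pm_iff)
      then show ?thesis using h n2
        by (intro exI[of _ h] exI[of _ 1] exI[of _ 2]) (simp add: adjacent_def)
    qed
  qed
  then obtain w p q where w: "w \<in> B_group n" "adjacent n p q"
    "w p = a \<and> w q = b \<or> w p = b \<and> w q = a" by auto
  have pq: "p \<in> pm n" "q \<in> pm n" using adjacent_pm assms w by auto
  have "w \<circ> brefl p q \<circ> inv w = brefl a b"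
    unfolding comp_brefl[OF w(1) pq] using w(3) B_group_inv[OF w(1)] brefl_commute[of a b] by auto
  then show "t \<in> B_reflections n"
    using w(1,2) ab(4) unfolding B_reflections_def B_gens_iff
    by (intro CollectI exI[of _ w] exI[of _ "brefl p q"]) auto
qed

text \<open>A reflection that creates an inversion is undone by one that removes it, so the length
  comparison is decided by the order of two values.\<close>

lemma bruhat_step_iff:
  assumes "n \<ge> 1" "u \<in> B_group n"
  shows "bruhat_step n u w \<longleftrightarrow>
    (\<exists>a\<in>pm n. \<exists>b\<in>pm n. a < b \<and> u a < u b \<and> w = u \<circ> brefl a b)"
proof -
  have "B_length n u < B_length n (u \<circ> brefl a b) \<longleftrightarrow> u a < u b"
    if ab: "a \<in> pm n" "b \<in> pm n" "a < b" for a b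
  proof (cases "u a < u b")
    case True
    let ?w = "u \<circ> brefl a b"
    have nz: "a \<noteq> 0" "b \<noteq> 0" using ab by (auto simp: pm_iff)
    have "?w \<in> B_group n" using B_group_comp brefl_in_B_group assms ab by blast
    moreover have "?w b < ?w a" using True nz ab(3) by (simp add: brefl_apply)
    ultimately have "B_length n (?w \<circ> brefl a b) < B_length n ?w"
      using B_length_descent assms(1) ab by blast
    then show ?thesis using True brefl_brefl[OF nz] by (simp add: comp_assoc del: o_apply)
  next
    case False
    then have "u b < u a" using B_group_inj[OF assms(2), of a b] ab by auto
    then show ?thesis using B_length_descent[OF assms ab] False by simp
  qed
  then show ?thesis
    unfolding bruhat_step_def Bex_def B_reflections_iff[OF assms(1)] by blast
qed

lemma bruhat_step_in_B_group:
  assumes "n \<ge> 1" "u \<in> B_group n" "bruhat_step n u w"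
  shows "w \<in> B_group n"
  using assms B_group_comp brefl_in_B_group unfolding bruhat_step_iff[OF assms(1,2)] by blast

section \<open>Bruhat order as domination of rank functions\<close>

lemma comp_brefl_brefl: "a \<noteq> 0 \<Longrightarrow> b \<noteq> 0 \<Longrightarrow> w \<circ> brefl a b \<circ> brefl a b = w"
  using brefl_brefl by (simp add: comp_assoc del: o_apply)

lemma bruhat_step_imp_rk_le:
  assumes "n \<ge> 1" "u \<in> B_group n" "bruhat_step n u w"
  shows "rk n u i x \<le> rk n w i x"
proof -
  obtain a b where ab: "a \<in> pm n" "b \<in> pm n" "a < b" "u a < u b" "w = u \<circ> brefl a b"
    using assms by (auto simp: bruhat_step_iff)
  then have nz: "a \<noteq> 0" "b \<noteq> 0" by (auto simp: pm_iff)
  have w: "w \<in> B_group n" using bruhat_step_in_B_group assms by blast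
  have "w b < w a" using ab nz by (simp add: brefl_apply)
  then have "rk n (w \<circ> brefl a b) i x \<le> rk n w i x"
    using rk_comp_brefl[OF w ab(1-3)] by simp
  then show ?thesis unfolding ab(5) comp_brefl_brefl[OF nz] .
qed

lemma bruhat_le_imp_rk_le:
  assumes "n \<ge> 1" "bruhat_le n u w"
  shows "rk n u i x \<le> rk n w i x"
proof -
  have "(bruhat_step n)\<^sup>*\<^sup>* u w" "u \<in> B_group n" using assms by (auto simp: bruhat_le_def)
  then have "w \<in> B_group n \<and> rk n u i x \<le> rk n w i x"
  proof (induction rule: rtranclp_induct)
    case (step v w)
    then show ?case
      using bruhat_step_in_B_group[OF assms(1)] bruhat_step_imp_rk_le[OF assms(1)] by (meson order_trans)
  qed simp
  then show ?thesis by simp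
qed

text \<open>Write \<open>s = brefl p q\<close>. Unless the step is multiplication by
  \<open>s\<close>, applying \<open>s\<close> keeps \<open>a\<close> and \<open>b\<close> in order,
  so the step conjugated by \<open>s\<close> still goes up.\<close>

lemma bruhat_step_comp_adjacent:
  assumes "n \<ge> 1" "u \<in> B_group n" "adjacent n p q" "bruhat_step n u w" "w \<noteq> u \<circ> brefl p q"
  shows "bruhat_step n (u \<circ> brefl p q) (w \<circ> brefl p q)"
proof -
  let ?s = "brefl p q"
  have pq: "p \<in> pm n" "q \<in> pm n" "p \<noteq> 0" "q \<noteq> 0"
    using adjacent_pm[OF assms(1,3)] by (auto simp: pm_iff)
  have s: "?s \<in> B_group n" using brefl_in_B_group pq by blast
  have us: "u \<circ> ?s \<in> B_group n" using B_group_comp s assms by blast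
  obtain a b where ab: "a \<in> pm n" "b \<in> pm n" "a < b" "u a < u b" "w = u \<circ> brefl a b"
    using assms by (auto simp: bruhat_step_iff)
  have "\<not> ?s b < ?s a"
    using brefl_inverts_adjacent[OF assms(3) ab(3)] ab assms(5) by (auto simp: pm_iff)
  then have less: "?s a < ?s b" using B_group_inj[OF s, of a b] ab by auto
  have ss: "?s (?s c) = c" for c using brefl_brefl[OF pq(3,4)] by (metis comp_apply id_apply)
  have "u \<circ> ?s \<circ> brefl (?s a) (?s b) = u \<circ> (brefl (?s (?s a)) (?s (?s b)) \<circ> ?s)"
    using comp_brefl[OF s, of "?s a" "?s b"] B_group_in_pm[OF s] ab by (simp add: comp_assoc del: o_apply)
  also have "\<dots> = w \<circ> ?s" using ab by (simp add: ss comp_assoc del: o_apply)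
  finally have "w \<circ> ?s = u \<circ> ?s \<circ> brefl (?s a) (?s b)" by simp
  then show ?thesis unfolding bruhat_step_iff[OF assms(1) us]
    using less ab B_group_in_pm[OF s] by (intro bexI[of _ "?s a"] bexI[of _ "?s b"]) (auto simp: ss)
qed

text \<open>The chain is multiplied by \<open>brefl p q\<close> step by step. At a step that is
  itself this multiplication, the new chain already stands at the end of the step and can follow the
  old chain from there.\<close>

lemma bruhat_steps_comp_adjacent:
  assumes "n \<ge> 1" "u \<in> B_group n" "adjacent n p q" "(bruhat_step n)\<^sup>*\<^sup>* u w"
  shows "w \<in> B_group n \<and> ((bruhat_step n)\<^sup>*\<^sup>* (u \<circ> brefl p q) (w \<circ> brefl p q) \<or>
    (bruhat_step n)\<^sup>*\<^sup>* (u \<circ> brefl p q) w)"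
  using assms(4)
proof (induction rule: rtranclp_induct)
  case base
  then show ?case using assms by simp
next
  case (step v w)
  then have "w \<in> B_group n" using bruhat_step_in_B_group[OF assms(1)] by blast
  then show ?case
    using step bruhat_step_comp_adjacent[OF assms(1) _ assms(3), of v w]
    by (metis rtranclp.rtrancl_into_rtrancl)
qed

text \<open>On the lost rectangle \<open>v\<close> gains at \<open>p\<close> and not at
  \<open>q\<close>. If \<open>u\<close> does not gain at \<open>p\<close>, compare the rows before
  \<open>p\<close> to get strictness; otherwise \<open>u\<close> gains at \<open>q\<close> too, and
  row \<open>q\<close> gives it.\<close>

lemma rk_le_comp_transpose:
  assumes "p \<in> pm n" "q \<in> pm n" "p < q" "\<And>a. a \<in> pm n \<Longrightarrow> p < a \<Longrightarrow> q \<le> a"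
    "u p < u q" "v q < v p" "\<And>i x. rk n u i x \<le> rk n v i x"
  shows "rk n u i x \<le> rk n (v \<circ> transpose p q) i x"
proof (cases "p \<le> i \<and> i < q \<and> v q < x \<and> x \<le> v p")
  case False
  then show ?thesis using rk_comp_transpose[OF assms(1-3,6)] assms(7)[of i x] by auto
next
  case True
  have i: "rk n f i x = rk n f p x" for f
    by (rule rk_row_gap) (use True assms(4) in force)+
  have q: "rk n f (q - 1) x = rk n f p x" for f
    by (rule rk_row_gap) (use assms(3,4) in force)+
  have "rk n u p x < rk n v p x"
    using rk_row[OF assms(1), of u x] rk_row[OF assms(1), of v x] rk_row[OF assms(2), of u x]
      rk_row[OF assms(2), of v x] q[of u] q[of v] True assms(5) assms(7)[of "p - 1" x] assms(7)[of q x]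
    by (auto split: if_splits)
  then show ?thesis
    using rk_comp_transpose[OF assms(1-3,6), of i x] i[of u] i[of v] True by simp
qed

text \<open>For \<open>p \<noteq> - q\<close> the transposition argument is used twice, the second
  time for the mirror pair \<open>(- q, - p)\<close>.\<close>

lemma rk_le_comp_brefl:
  assumes "n \<ge> 1" "u \<in> B_group n" "v \<in> B_group n" "adjacent n p q" "u p < u q" "v q < v p"
    "\<And>i x. rk n u i x \<le> rk n v i x"
  shows "rk n u i x \<le> rk n (v \<circ> brefl p q) i x"
proof -
  have pq: "p \<in> pm n" "q \<in> pm n" "p < q" using adjacent_pm assms by auto
  have gap: "q \<le> a" if "a \<in> pm n" "p < a" for a
    using that assms(4) by (auto simp: adjacent_def pm_iff)
  have le: "rk n u i x \<le> rk n (v \<circ> transpose p q) i x" for i x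
    using rk_le_comp_transpose[OF pq gap assms(5-7)] by simp
  show ?thesis
  proof (cases "p = - q")
    case True
    then show ?thesis using le by (simp add: brefl_def)
  next
    case False
    have "rk n u i x \<le> rk n ((v \<circ> transpose p q) \<circ> transpose (- q) (- p)) i x"
    proof (rule rk_le_comp_transpose)
      show "- p \<le> a" if "a \<in> pm n" "- q < a" for a
        using gap[of "- a"] that assms(4) False by (auto simp: adjacent_def)
      show "u (- q) < u (- p)" using assms(5) B_group_minus[OF assms(2)] by simp
      show "(v \<circ> transpose p q) (- p) < (v \<circ> transpose p q) (- q)"
        using assms(6) False pq B_group_minus[OF assms(3)] by (auto simp: transpose_def pm_iff)
    qed (use pq le in \<open>auto simp: pm_minus\<close>)
    then show ?thesis
      using False by (simp add: brefl_def stransp_def comp_assoc transpose_commute del: o_apply)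
  qed
qed

text \<open>The identity has rank 0 at \<open>(a, a + 1)\<close>, which forces
  \<open>u a \<le> a\<close>; the same at \<open>- a\<close> gives equality.\<close>

lemma rk_le_id:
  assumes "u \<in> B_group n" "\<And>i x. rk n u i x \<le> rk n id i x"
  shows "u = id"
proof -
  have le: "u a \<le> a" if "a \<in> pm n" for a
  proof (rule ccontr)
    assume "\<not> u a \<le> a"
    then have "rk n u a (a + 1) = rk n u (a - 1) (a + 1) + 1"
      using rk_row[OF that, of u "a + 1"] by simp
    moreover have "rk n id a (a + 1) = 0" unfolding rk_def by (rule sum.neutral) auto
    ultimately show False using assms(2)[of a "a + 1"] rk_nonneg[of n u "a - 1" "a + 1"] by simp
  qed
  show ?thesis
  proof
    fix a
    show "u a = id a"
      using le[of a] le[of "- a"] B_group_minus[OF assms(1), of a] B_group_outside[OF assms(1), of a]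
      by (cases "a \<in> pm n") (auto simp: pm_minus)
  qed
qed

text \<open>Induction along a descent \<open>(p, q)\<close> of \<open>v\<close>: it is removed from
  \<open>v\<close>, and from \<open>u\<close> as well if \<open>u\<close> has it.\<close>

lemma rk_le_imp_bruhat_le:
  assumes "n \<ge> 1" "u \<in> B_group n" "v \<in> B_group n" "\<And>i x. rk n u i x \<le> rk n v i x"
  shows "bruhat_le n u v"
  using assms(2-4)
proof (induction "rk_sum n v" arbitrary: u v rule: less_induct)
  case less
  from less.prems(2) assms(1) show ?case
  proof (cases rule: B_group_descent_cases)
    case 1
    then show ?thesis using rk_le_id less.prems by (auto simp: bruhat_le_def)
  next
    case (2 p q)
    let ?s = "brefl p q"
    have pq: "p \<in> pm n" "q \<in> pm n" "p < q" "p \<noteq> 0" "q \<noteq> 0"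
      using adjacent_pm[OF assms(1) 2(1)] by (auto simp: pm_iff)
    have s: "?s \<in> B_group n" using brefl_in_B_group pq by blast
    have vs: "v \<circ> ?s \<in> B_group n" and us: "u \<circ> ?s \<in> B_group n"
      using B_group_comp s less.prems by auto
    have "(v \<circ> ?s) p < (v \<circ> ?s) q" using 2 pq by (simp add: brefl_apply)
    then have up: "bruhat_step n (v \<circ> ?s) v"
      unfolding bruhat_step_iff[OF assms(1) vs] using pq comp_brefl_brefl by metis
    note IH = less.hyps[OF rk_sum_descent[OF less.prems(2) pq(1-3) 2(2)] _ vs]
    show ?thesis
    proof (cases "u p < u q")
      case True
      then have "bruhat_le n u (v \<circ> ?s)"
        using IH less.prems rk_le_comp_brefl[OF assms(1) less.prems(1,2) 2(1) _ 2(2)] by blast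
      then show ?thesis using up less.prems
        by (auto simp: bruhat_le_def intro: rtranclp.rtrancl_into_rtrancl)
    next
      case False
      then have qp: "u q < u p" using B_group_inj[OF less.prems(1), of p q] pq by auto
      have "rk n (u \<circ> ?s) i x \<le> rk n v i x" for i x
        using rk_comp_brefl[OF less.prems(1) pq(1-3) qp, of i x] less.prems(3)[of i x]
        by (smt (verit) of_bool_eq_iff of_bool_def)
      moreover have "(u \<circ> ?s) p < (u \<circ> ?s) q" using qp pq by (simp add: brefl_apply)
      ultimately have "bruhat_le n (u \<circ> ?s) (v \<circ> ?s)"
        using IH us rk_le_comp_brefl[OF assms(1) us less.prems(2) 2(1) _ 2(2)] by blast
      then have "(bruhat_step n)\<^sup>*\<^sup>* (u \<circ> ?s) (v \<circ> ?s)" by (simp add: bruhat_le_def)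
      \<comment> \<open>Multiplying back by \<open>?s\<close> ends the chain at \<open>v\<close> or
        at \<open>v \<circ> ?s\<close>, and the latter lies one step below \<open>v\<close>.\<close>
      from bruhat_steps_comp_adjacent[OF assms(1) us 2(1) this]
      have "(bruhat_step n)\<^sup>*\<^sup>* u v \<or> (bruhat_step n)\<^sup>*\<^sup>* u (v \<circ> ?s)"
        unfolding comp_brefl_brefl[OF pq(4,5)] by blast
      then show ?thesis using up less.prems
        by (auto simp: bruhat_le_def intro: rtranclp.rtrancl_into_rtrancl)
    qed
  qed
qed

section \<open>Value pairs and their positions\<close>

text \<open>The odd involution extending \<open>a \<mapsto> a\<^sup>*\<close>; its orbits are
  \<open>{2k - 1, 2k}\<close> and their negatives.\<close>

definition mate :: "int \<Rightarrow> int" where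
  "mate y = (if (0 < y) = even y then y - 1 else y + 1)"

lemma mate_mate: "y \<noteq> 0 \<Longrightarrow> mate (mate y) = y"
  unfolding mate_def by presburger

lemma mate_minus: "y \<noteq> 0 \<Longrightarrow> mate (- y) = - mate y"
  by (auto simp: mate_def)

lemma mate_range: "y \<noteq> 0 \<Longrightarrow> \<bar>y\<bar> \<le> 2 * int m \<Longrightarrow> mate y \<noteq> 0 \<and> \<bar>mate y\<bar> \<le> 2 * int m"
  unfolding mate_def by presburger

lemma W_set_in_B_group: "w \<in> W_set n \<Longrightarrow> w \<in> B_group n"
  by (simp add: W_set_def)

lemma B_group_inv_minus: "w \<in> B_group n \<Longrightarrow> inv w (- y) = - inv w y"
  using B_group_inv(1)[of w n y] B_group_inv(2)[of w n "- inv w y"] B_group_minus[of w n "inv w y"]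
  by simp

text \<open>On \<open>1..2m\<close> the function \<open>star\<close> agrees with
  \<open>mate\<close>; negative values follow by oddness.\<close>

lemma W_set_mate:
  assumes "w \<in> W_set (2 * m + 1)" "y \<noteq> 0" "\<bar>y\<bar> \<le> 2 * int m"
  shows "\<bar>inv w y - inv w (mate y)\<bar> \<le> 1"
proof -
  have w: "w \<in> B_group (2 * m + 1)" using assms(1) by (rule W_set_in_B_group)
  have pos: "\<bar>inv w a - inv w (mate a)\<bar> \<le> 1" if "0 < a" "a \<le> 2 * int m" for a
  proof -
    have "star (2 * m + 1) a = mate a" using that by (auto simp: star_def mate_def)
    moreover have "a \<in> {1..int (2 * m + 1) - 1}" using that by simp
    ultimately show ?thesis using assms(1) unfolding W_set_def by (metis (mono_tags, lifting) mem_Collect_eq)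
  qed
  show ?thesis
  proof (cases "0 < y")
    case True
    then show ?thesis using pos assms by simp
  next
    case False
    then show ?thesis
      using pos[of "- y"] assms B_group_inv_minus[OF w] mate_minus[OF assms(2)] by simp
  qed
qed

text \<open>The cut after position \<open>i\<close> splits a value pair. The bound keeps out the
  unpaired values \<open>2m + 1\<close> and \<open>- (2m + 1)\<close>.\<close>

definition mated :: "nat \<Rightarrow> (int \<Rightarrow> int) \<Rightarrow> int \<Rightarrow> bool" where
  "mated m w i \<longleftrightarrow> w i \<noteq> 0 \<and> \<bar>w i\<bar> \<le> 2 * int m \<and> w (i + 1) = mate (w i)"

text \<open>No value pair lying in \<open>[x, \<infinity>)\<close> is separated by the cut after position \<open>i\<close>.\<close>

definition closed_cut :: "nat \<Rightarrow> (int \<Rightarrow> int) \<Rightarrow> int \<Rightarrow> int \<Rightarrow> bool" where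
  "closed_cut m w i x \<longleftrightarrow> (\<forall>y. y \<noteq> 0 \<and> \<bar>y\<bar> \<le> 2 * int m \<and> x \<le> y \<and> x \<le> mate y \<longrightarrow>
    (inv w y \<le> i \<longleftrightarrow> inv w (mate y) \<le> i))"

text \<open>Mates are at most one position apart, so only a pair at \<open>i\<close> and
  \<open>i + 1\<close> can be separated; by hypothesis such a pair is not entirely above the
  threshold.\<close>

lemma W_set_closed_cut:
  assumes w: "w \<in> W_set (2 * m + 1)" and "mated m w i \<Longrightarrow> w i < x \<or> w (i + 1) < x"
  shows "closed_cut m w i x"
proof (rule ccontr)
  assume "\<not> closed_cut m w i x"
  then obtain y where y: "y \<noteq> 0" "\<bar>y\<bar> \<le> 2 * int m" "x \<le> y" "x \<le> mate y"
    "inv w y \<le> i \<longleftrightarrow> \<not> inv w (mate y) \<le> i"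
    by (auto simp: closed_cut_def)
  have wB: "w \<in> B_group (2 * m + 1)" using w by (rule W_set_in_B_group)
  have "(inv w y = i \<and> inv w (mate y) = i + 1) \<or> (inv w (mate y) = i \<and> inv w y = i + 1)"
    using W_set_mate[OF w y(1,2)] y(5) by auto
  then have "(w i = y \<and> w (i + 1) = mate y) \<or> (w i = mate y \<and> w (i + 1) = y)"
    using B_group_inv(1)[OF wB] by metis
  then show False
    using assms(2) y mate_mate[of y] mate_range[of y m] by (auto simp: mated_def)
qed

lemma mated_cases:
  assumes w: "w \<in> W_set (2 * m + 1)" and "w i \<noteq> 0" "\<bar>w i\<bar> \<le> 2 * int m"
  shows "mated m w i \<or> mated m w (i - 1)"
proof -
  have wB: "w \<in> B_group (2 * m + 1)" using w by (rule W_set_in_B_group)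
  have "\<bar>i - inv w (mate (w i))\<bar> \<le> 1"
    using W_set_mate[OF assms] B_group_inv(2)[OF wB] by simp
  moreover have "mate (w i) \<noteq> w i" by (simp add: mate_def)
  then have "inv w (mate (w i)) \<noteq> i" using B_group_inv(1)[OF wB] by metis
  ultimately have "inv w (mate (w i)) = i + 1 \<or> inv w (mate (w i)) = i - 1" by auto
  then have "w (i + 1) = mate (w i) \<or> w (i - 1) = mate (w i)"
    using B_group_inv(1)[OF wB] by metis
  then show ?thesis
    using assms mate_mate[of "w i"] mate_range[of "w i" m] by (auto simp: mated_def)
qed

lemma mated_not_Suc:
  assumes "w \<in> B_group n" "mated m w i"
  shows "\<not> mated m w (i + 1)"
proof
  assume "mated m w (i + 1)"
  then have "w (i + 1 + 1) = w i" using assms mate_mate by (auto simp: mated_def)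
  then show False using B_group_inj[OF assms(1)] by simp
qed

lemma mated_Suc_range: "mated m w i \<Longrightarrow> w (i + 1) \<noteq> 0 \<and> \<bar>w (i + 1)\<bar> \<le> 2 * int m"
  using mate_range by (auto simp: mated_def)

text \<open>Up to sign the top value sits at some \<open>q > 0\<close>. The positions before
  \<open>q\<close> are filled from 1 onwards by pairs at \<open>(1, 2)\<close>,
  \<open>(3, 4)\<close> and so on, so their number is even.\<close>

lemma W_set_top_odd:
  assumes w: "w \<in> W_set (2 * m + 1)"
  shows "odd (inv w (int (2 * m + 1)))"
proof
  let ?n = "int (2 * m + 1)"
  define q where "q = nat \<bar>inv w ?n\<bar>"
  assume "even (inv w ?n)"
  then have even: "even q" by (simp add: q_def even_nat_iff)
  have wB: "w \<in> B_group (2 * m + 1)" using w by (rule W_set_in_B_group)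
  have wq: "\<bar>w (int q)\<bar> = ?n"
    using B_group_inv(1)[OF wB, of ?n] B_group_minus[OF wB, of "inv w ?n"] by (auto simp: q_def abs_if)
  then have "w (int q) \<noteq> 0" by auto
  then have q0: "q > 0" using B_group_zero[OF wB] by (cases "q = 0") auto
  have qn: "int q \<le> ?n"
    using B_group_in_pm[OF wB, of "int q"] wq by (auto simp: pm_iff)
  have inside: "w (int k) \<noteq> 0 \<and> \<bar>w (int k)\<bar> \<le> 2 * int m" if "0 < k" "k < q" for k
  proof -
    have "w (int k) \<in> pm (2 * m + 1)"
      using B_group_in_pm[OF wB, of "int k"] that qn by (auto simp: pm_iff)
    moreover have "w (int k) \<noteq> w (int q)" "w (int k) \<noteq> w (- int q)"
      using B_group_inj[OF wB] that by auto
    ultimately show ?thesis using wq B_group_minus[OF wB, of "int q"] by (auto simp: pm_iff)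
  qed
  have cut: "\<not> mated m w (int (2 * k))" if "2 * k < q" for k
    using that
  proof (induction k)
    case 0
    then show ?case using B_group_zero[OF wB] by (simp add: mated_def)
  next
    case (Suc k)
    have "mated m w (int (2 * k + 1))"
      using mated_cases[OF w, of "int (2 * k + 1)"] inside[of "2 * k + 1"] Suc by auto
    from mated_not_Suc[OF wB this] show ?case by (simp add: add.commute)
  qed
  obtain k' where "q = 2 * k'" using even by (rule evenE)
  with q0 obtain k where k: "q = 2 * k + 2" by (cases k') auto
  \<comment> \<open>For even \<open>q\<close> the value at \<open>q - 1\<close> would have to be
    paired with the top value.\<close>
  have "mated m w (int (2 * k + 1))"
    using mated_cases[OF w, of "int (2 * k + 1)"] inside[of "2 * k + 1"] cut[of k] k by auto
  from mated_Suc_range[OF this] have "\<bar>w (int q)\<bar> \<le> 2 * int m" using k by (simp add: add.commute)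
  then show False using wq by simp
qed

section \<open>The parity argument\<close>

text \<open>The condition \<open>(0 < x) = odd x\<close> says that no value pair is split by the threshold \<open>x\<close>.\<close>

lemma rk_less_of_closed_cut:
  assumes "u \<in> B_group (2 * m + 1)" "v \<in> B_group (2 * m + 1)"
    and le: "\<And>x. rk (2 * m + 1) u i x \<le> rk (2 * m + 1) v i x"
    and top: "inv v (int (2 * m + 1)) \<le> i" "i < inv u (int (2 * m + 1))"
    and cl: "closed_cut m u i x\<^sub>0" "closed_cut m v i x\<^sub>0"
    and x0: "- 2 * int m \<le> x\<^sub>0" "(0 < x\<^sub>0) = odd x\<^sub>0"
    and x: "x\<^sub>0 \<le> x" "x \<le> int (2 * m + 1)"
  shows "rk (2 * m + 1) u i x < rk (2 * m + 1) v i x"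
proof -
  define D where "D = (\<lambda>x. rk (2 * m + 1) v i x - rk (2 * m + 1) u i x)"
  let ?M = "\<lambda>w x. of_bool (x \<noteq> 0 \<and> \<bar>x\<bar> \<le> int (2 * m + 1) \<and> inv w x \<le> i) :: int"
  have D: "D x = D (x + 1) + ?M v x - ?M u x" for x
    unfolding D_def using rk_column[OF assms(1), of i x] rk_column[OF assms(2), of i x]
    by (simp add: pm_iff)
  have D0: "D x \<ge> 0" for x using le unfolding D_def by simp
  have "rk (2 * m + 1) w i (int (2 * m + 1) + 1) = 0" if "w \<in> B_group (2 * m + 1)" for w
    unfolding rk_def
  proof (rule sum.neutral, rule ballI)
    fix a assume "a \<in> pm (2 * m + 1)"
    then have "w a \<in> pm (2 * m + 1)" using B_group_in_pm[OF that] by simp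
    then show "of_bool (a \<le> i \<and> int (2 * m + 1) + 1 \<le> w a) = (0::int)" by (auto simp: pm_iff)
  qed
  then have "D (int (2 * m + 1) + 1) = 0" using assms(1,2) by (simp add: D_def)
  \<comment> \<open>The top value is counted for \<open>v\<close> and not for \<open>u\<close>. The
    induction descends from this gap of 1, and since \<open>x\<^sub>0 \<ge> - 2 * m\<close> it never
    meets the unpaired value \<open>- (2m + 1)\<close>.\<close>
  then have Dn: "D (int (2 * m + 1)) = 1" using D[of "int (2 * m + 1)"] top by simp
  have pair: "?M u (x - 1) = ?M u x \<and> ?M v (x - 1) = ?M v x"
    if "x\<^sub>0 < x" "x < int (2 * m + 1)" "(0 < x) = even x" "x \<noteq> 0" for x
  proof -
    have "mate x = x - 1" using that by (simp add: mate_def)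
    moreover have "x - 1 \<noteq> 0" using that by auto
    ultimately show ?thesis using cl that x0 by (auto simp: closed_cut_def)
  qed
  have "D x > 0 \<and> ((0 < x) = odd x \<longrightarrow> odd (D x))"
    using x
  proof (induction "nat (int (2 * m + 1) - x)" arbitrary: x rule: less_induct)
    case less
    have IH: "D y > 0" "(0 < y) = odd y \<Longrightarrow> odd (D y)" if "x < y" "y \<le> int (2 * m + 1)" for y
      using less.hyps[of y] less.prems that by auto
    consider "x = int (2 * m + 1)" | "x = 0" | "x < int (2 * m + 1)" "x \<noteq> 0" "(0 < x) = even x"
      | "x < int (2 * m + 1)" "x \<noteq> 0" "(0 < x) = odd x"
      using less.prems by linarith
    then show ?case
    proof cases
      case 1
      then show ?thesis using Dn by simp
    next
      case 2
      then show ?thesis using D[of 0] IH[of 1] by simp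
    next
      case 3
      have x0x: "x\<^sub>0 < x" using 3 x0 less.prems by (cases "x = x\<^sub>0") auto
      have "(0 < x + 1) = odd (x + 1)" using 3 by presburger
      then have "D (x + 1) > 0" "odd (D (x + 1))" using IH[of "x + 1"] 3 by auto
      \<comment> \<open>At a threshold splitting a pair, the gap is the mean of its two neighbours,
        one positive and the other nonnegative.\<close>
      moreover have "D (x - 1) = D (x + 1) + 2 * (?M v x - ?M u x)"
        using D[of x] D[of "x - 1"] pair[OF x0x 3(1,3,2)] by simp
      moreover have "D (x - 1) \<ge> 0" by (rule D0)
      ultimately have "D x > 0" using D[of x] by (auto split: if_splits simp: of_bool_def)
      moreover have "(0 < x) \<noteq> odd x" using 3 by simp
      ultimately show ?thesis by simp
    next
      case 4
      have top: "(0 < x + 1) = even (x + 1)" "x + 1 \<noteq> 0" "x + 1 < int (2 * m + 1)"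
        "(0 < x + 2) = odd (x + 2)"
        using 4 by presburger+
      have "odd (D (x + 2))" using IH(2)[of "x + 2"] top by simp
      \<comment> \<open>Both members of the pair \<open>{x, x + 1}\<close> lie on the same side of
        the cut, so the gap keeps its parity; odd and nonnegative, it is positive.\<close>
      moreover have "D x = D (x + 2) + 2 * (?M v x - ?M u x)"
        using D[of x] D[of "x + 1"] pair[OF _ top(3,1,2)] less.prems by (simp add: add.commute)
      ultimately have "odd (D x)" by simp
      moreover have "D x \<noteq> 0" using calculation by auto
      ultimately show ?thesis using D0[of x] by simp
    qed
  qed
  then show ?thesis by (simp add: D_def)
qed

section \<open>Mirror symmetry and the operation \<open>c\<close>\<close>

text \<open>Negate positions and values, then take complements. The right-hand side does not involve
  \<open>w\<close>, so strict rank inequalities pass to mirror points.\<close>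

lemma rk_symmetry:
  assumes "w \<in> B_group n"
  shows "rk n w i x - rk n w (- i - 1) (1 - x) =
    (\<Sum>a\<in>pm n. of_bool (- i \<le> a)) - (\<Sum>a\<in>pm n. of_bool (1 - x \<le> a))"
proof -
  have neg: "bij_betw uminus (pm n) (pm n)"
    by (rule bij_betwI[of _ _ _ uminus]) (auto simp: pm_minus)
  have perm: "bij_betw w (pm n) (pm n)"
    using assms permutes_imp_bij by (auto simp: B_group_def)
  have "rk n w i x = (\<Sum>a\<in>pm n. of_bool (- a \<le> i \<and> x \<le> w (- a)))"
    unfolding rk_def by (rule sum.reindex_bij_betw[OF neg, symmetric])
  also have "\<dots> = (\<Sum>a\<in>pm n. of_bool (- i \<le> a) - of_bool (1 - x \<le> w a)
      + of_bool (a \<le> - i - 1 \<and> 1 - x \<le> w a))"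
    by (rule sum.cong) (auto simp: B_group_minus[OF assms])
  also have "\<dots> = (\<Sum>a\<in>pm n. of_bool (- i \<le> a)) - (\<Sum>a\<in>pm n. of_bool (1 - x \<le> w a))
      + rk n w (- i - 1) (1 - x)"
    by (simp add: rk_def sum.distrib sum_subtractf)
  also have "(\<Sum>a\<in>pm n. of_bool (1 - x \<le> w a)) = (\<Sum>a\<in>pm n. of_bool (1 - x \<le> a) :: int)"
    by (rule sum.reindex_bij_betw[OF perm])
  finally show ?thesis by simp
qed

text \<open>The condition on the signs of \<open>p\<close> and \<open>q\<close> keeps the rectangle
  apart from its mirror image, so at most one unit is lost at each point; strictness on the mirror
  image comes from \<open>rk_symmetry\<close>.\<close>

lemma rk_le_comp_brefl_of_less:
  assumes u: "u \<in> B_group n" and v: "v \<in> B_group n"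
    and pq: "p \<in> pm n" "q \<in> pm n" "p < q" "0 < p \<or> q < 0 \<or> p = - q" and vpq: "v q < v p"
    and le: "\<And>i x. rk n u i x \<le> rk n v i x"
    and less: "\<And>i x. p \<le> i \<Longrightarrow> i < q \<Longrightarrow> v q < x \<Longrightarrow> x \<le> v p \<Longrightarrow> rk n u i x < rk n v i x"
  shows "rk n u i x \<le> rk n (v \<circ> brefl p q) i x"
proof -
  let ?P = "p \<le> i \<and> i < q \<and> v q < x \<and> x \<le> v p"
  let ?Q = "p \<noteq> - q \<and> - q \<le> i \<and> i < - p \<and> - v p < x \<and> x \<le> - v q"
  have eq: "rk n (v \<circ> brefl p q) i x = rk n v i x - of_bool ?P - of_bool ?Q"
    using rk_comp_brefl[OF v pq(1-3) vpq] by simp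
  have "\<not> (?P \<and> ?Q)" using pq by auto
  moreover have "rk n u i x < rk n v i x" if ?Q
  proof -
    have "rk n u (- i - 1) (1 - x) < rk n v (- i - 1) (1 - x)"
      by (rule less) (use that in auto)
    then show ?thesis using rk_symmetry[OF u, of i x] rk_symmetry[OF v, of i x] by simp
  qed
  ultimately show ?thesis using eq le[of i x] less[of i x] by auto
qed

theorem theorem4p9:
  fixes m :: nat and u v :: "int \<Rightarrow> int"
  assumes "m \<ge> 1"
    and "u \<in> W_set (2 * m + 1)" and "v \<in> W_set (2 * m + 1)"
    and "bruhat_less (2 * m + 1) u v"
    and "inv v (int (2 * m + 1)) < inv u (int (2 * m + 1))"
  shows "bruhat_le (2 * m + 1) u (c_op (2 * m + 1) v)"
proof -
  define n where "n = 2 * m + 1"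
  have n1: "n \<ge> 1" and nm: "int n = 2 * int m + 1" by (auto simp: n_def)
  have uW: "u \<in> W_set (2 * m + 1)" and vW: "v \<in> W_set (2 * m + 1)" using assms by auto
  have u: "u \<in> B_group n" and v: "v \<in> B_group n"
    using assms W_set_in_B_group by (auto simp: n_def)
  have le: "rk n u i x \<le> rk n v i x" for i x
    using bruhat_le_imp_rk_le[OF n1] assms(4) by (simp add: bruhat_less_def n_def)
  define j where "j = inv v (int n)"
  define k where "k = inv u (int n)"
  have vj: "v j = int n" and uk: "u k = int n"
    unfolding j_def k_def using B_group_inv(1) u v by blast+
  have jk: "j < k" using assms(5) by (simp add: j_def k_def n_def)
  have odd: "odd j" "odd k"
    using W_set_top_odd[OF uW] W_set_top_odd[OF vW] by (auto simp: j_def k_def n_def)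
  have "j \<in> pm n" "k \<in> pm n"
    using B_group_in_pm[OF v, of j] B_group_in_pm[OF u, of k] vj uk n1 by (auto simp: pm_iff)
  then have jn: "\<bar>j\<bar> \<le> int n" "j < int n" using jk by (auto simp: pm_iff)
  have less: "rk n u i x < rk n v i x"
    if "j \<le> i" "i < k" "closed_cut m u i x\<^sub>0" "closed_cut m v i x\<^sub>0" "- 2 * int m \<le> x\<^sub>0"
      "(0 < x\<^sub>0) = odd x\<^sub>0" "x\<^sub>0 \<le> x" "x \<le> int n" for i x x\<^sub>0
    using rk_less_of_closed_cut[of u m v i x\<^sub>0 x] u v le that unfolding n_def j_def k_def by blast
  \<comment> \<open>The threshold \<open>- 2 * m\<close> lies below no paired value's reach: it is
    the least of them, so a cut splitting no pair of \<open>u\<close> or \<open>v\<close> works for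
    every \<open>x\<close> in the range.\<close>
  have less_all: "rk n u i x < rk n v i x"
    if "j \<le> i" "i < k" "\<not> mated m u i" "\<not> mated m v i" "- int n < x" "x \<le> int n" for i x
    by (rule less[of i "- 2 * int m"])
      (use that uW vW W_set_closed_cut nm in \<open>auto\<close>)
  have "\<exists>p q. c_op n v = v \<circ> brefl p q \<and> p \<in> pm n \<and> q \<in> pm n \<and>
    (\<forall>i x. rk n u i x \<le> rk n (v \<circ> brefl p q) i x)"
  proof (cases "j = - 1")
    case True
    have c: "c_op n v = v \<circ> brefl (- 1) 1"
      using True by (simp add: c_op_def Let_def j_def brefl_def transpose_commute)
    have pm: "- 1 \<in> pm n" "1 \<in> pm n" using n1 by (auto simp: pm_iff)
    have v1: "v 1 = - int n" using B_group_minus[OF v, of j] vj True by simp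
    have um: "\<not> mated m u (- 1)"
      using mated_Suc_range[of m u "- 1"] B_group_zero[OF u] by auto
    have vm: "\<not> mated m v (- 1)" using vj True nm by (simp add: mated_def)
    have "rk n u i x \<le> rk n (v \<circ> brefl (- 1) 1) i x" for i x
    proof (rule rk_le_comp_brefl_of_less[OF u v pm _ _ _ le])
      fix i x :: int
      assume i: "- 1 \<le> i" "i < 1" and x: "v 1 < x" "x \<le> v (- 1)"
      have "rk n w i x = rk n w (- 1) x" for w
        by (rule rk_row_gap) (use i in \<open>auto simp: pm_iff\<close>)
      then show "rk n u i x < rk n v i x"
        using less_all[of "- 1" x] jk True um vm x v1 vj by simp
    qed (use v1 vj True n1 in auto)
    then show ?thesis using c pm by blast
  next
    case False
    \<comment> \<open>Thus \<open>j\<close>, \<open>j + 1\<close> and \<open>j + 2\<close> lie on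
      the same side of 0.\<close>
    have j13: "j \<ge> 1 \<or> j \<le> - 3" using False odd(1) by presburger
    have jn2: "j + 2 \<le> int n" using jn odd(1) nm by presburger
    have pm: "j \<in> pm n" "j + 1 \<in> pm n" "j + 2 \<in> pm n" using jn jn2 j13 by (auto simp: pm_iff)
    have vj1: "v (j + 1) \<noteq> 0 \<and> \<bar>v (j + 1)\<bar> \<le> 2 * int m"
    proof -
      have "v (j + 1) \<noteq> v j" "v (j + 1) \<noteq> v (- j)" using B_group_inj[OF v] odd(1) by presburger+
      moreover have "v (j + 1) \<in> pm n" using B_group_in_pm[OF v] pm by simp
      ultimately show ?thesis using vj B_group_minus[OF v, of j] nm by (auto simp: pm_iff)
    qed
    have nvj: "\<not> mated m v j" using vj nm by (simp add: mated_def)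
    \<comment> \<open>Position \<open>j\<close> holds the unpaired top value, so the value at
      \<open>j + 1\<close> has its mate at \<open>j + 2\<close>.\<close>
    then have vmate: "mated m v (j + 1)" using mated_cases[OF vW, of "j + 1"] vj1 by simp
    then have nvj2: "\<not> mated m v (j + 2)" using mated_not_Suc[OF v vmate] by (simp add: add.assoc)
    have vj2: "v (j + 2) = mate (v (j + 1))" using vmate by (simp add: mated_def add.assoc)
    have kj1: "j + 1 < k" using jk odd by presburger
    have kj2: "j + 2 < k" if "mated m u (j + 1)"
    proof -
      have "\<bar>u (j + 2)\<bar> \<le> 2 * int m" using mated_Suc_range[OF that] by (simp add: add.assoc)
      then have "k \<noteq> j + 2" using uk nm by auto
      then show ?thesis using kj1 by simp
    qed
    have nuj: "\<not> mated m u j" "\<not> mated m u (j + 2)" if "mated m u (j + 1)"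
      using mated_not_Suc[OF u, of m j] mated_not_Suc[OF u that] that by (auto simp: add.assoc)
    have rowv: "rk n v (j + 1) x = rk n v j x + of_bool (x \<le> v (j + 1))"
      "rk n v (j + 2) x = rk n v (j + 1) x + of_bool (x \<le> v (j + 2))" for x
      using rk_row[OF pm(2), of v x] rk_row[OF pm(3), of v x] by (simp_all add: add.commute)
    show ?thesis
    proof (cases "v (j + 1) > v (j + 2)")
      case True
      \<comment> \<open>The pair is \<open>{x - 1, x}\<close>, so the lost rectangle is the single
        point \<open>(j + 1, x)\<close>.\<close>
      define x where "x = v (j + 1)"
      have x: "x \<noteq> 0" "\<bar>x\<bar> \<le> 2 * int m" "v (j + 2) = x - 1" "(0 < x) = even x"
        using vj1 vj2 True by (auto simp: x_def mate_def split: if_splits)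
      have c: "c_op n v = v \<circ> brefl (j + 1) (j + 2)"
        using True False odd(1) by (auto simp: c_op_def Let_def brefl_def simp flip: j_def)
      have strict: "rk n u (j + 1) x < rk n v (j + 1) x"
      proof (cases "mated m u (j + 1)")
        case True
        \<comment> \<open>The cut after \<open>j + 1\<close> splits a pair of \<open>u\<close>; the
          cut after \<open>j\<close> splits none, and between the two \<open>v\<close> gains one and
          \<open>u\<close> at most one.\<close>
        have "rk n u j x < rk n v j x"
          by (rule less_all) (use jk nuj True nvj x nm in auto)
        then show ?thesis using rk_row[OF pm(2), of u x] rowv(1)[of x] by (simp add: x_def)
      next
        case nm1: False
        \<comment> \<open>Above \<open>x\<close> the pair of \<open>v\<close> is not counted and the
          cut is closed; lowering the threshold to \<open>x\<close> adds one for \<open>v\<close>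
          and at most one for \<open>u\<close>.\<close>
        have "rk n u (j + 1) (x + 1) < rk n v (j + 1) (x + 1)"
        proof (rule less[of _ "x + 1"])
          show "closed_cut m u (j + 1) (x + 1)" using W_set_closed_cut[OF uW] nm1 by blast
          show "closed_cut m v (j + 1) (x + 1)" using W_set_closed_cut[OF vW] by (simp add: x_def)
          show "(0 < x + 1) = odd (x + 1)" using x(1,4) by presburger
        qed (use kj1 x nm in auto)
        moreover have "x \<in> pm n" "inv v x = j + 1"
          using x nm B_group_inv(2)[OF v] by (auto simp: pm_iff x_def)
        ultimately show ?thesis
          using rk_column[OF u, of "j + 1" x] rk_column[OF v, of "j + 1" x] by simp
      qed
      have "rk n u i y \<le> rk n (v \<circ> brefl (j + 1) (j + 2)) i y" for i y
      proof (rule rk_le_comp_brefl_of_less[OF u v pm(2,3) _ _ _ le])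
        fix i y
        assume "j + 1 \<le> i" "i < j + 2" "v (j + 2) < y" "y \<le> v (j + 1)"
        then have "i = j + 1" "y = x" using x(3) by (auto simp: x_def)
        then show "rk n u i y < rk n v i y" using strict by simp
      qed (use j13 True in auto)
      then show ?thesis using c pm by blast
    next
      case nless: False
      \<comment> \<open>Here the pair is \<open>{a - 1, a}\<close>, and the lost rectangle consists
        of the cuts after \<open>j\<close> and \<open>j + 1\<close> with thresholds above
        \<open>a\<close>.\<close>
      define a where "a = v (j + 2)"
      have a: "v (j + 1) = a - 1" "a \<noteq> 0" "\<bar>a\<bar> \<le> 2 * int m" "(0 < a) = even a"
        using vj1 vj2 nless mate_range[of "v (j + 1)" m]
        unfolding a_def mate_def by (auto split: if_splits)
      have c: "c_op n v = v \<circ> brefl j (j + 2)"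
        using nless False by (auto simp: c_op_def Let_def brefl_def simp flip: j_def)
      have strict: "rk n u (j + 1) x < rk n v (j + 1) x" if x: "a < x" "x \<le> int n" for x
      proof (cases "mated m u (j + 1)")
        case True
        \<comment> \<open>The next cut splits no pair; moving back from it leaves the rank of
          \<open>v\<close> unchanged, since \<open>a < x\<close>, and cannot raise that of
          \<open>u\<close>.\<close>
        have "rk n u (j + 2) x < rk n v (j + 2) x"
          by (rule less_all) (use kj2 nuj True nvj2 x a nm in auto)
        then show ?thesis
          using rowv(2)[of x] rk_mono_row[of "j + 1" "j + 2" n u x] x by (simp add: a_def)
      next
        case nm1: False
        \<comment> \<open>The pair of \<open>v\<close> lies below \<open>a + 1\<close>, so the cut
          is closed there for \<open>v\<close> too.\<close>
        show ?thesis
        proof (rule less[of _ "a + 1"])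
          show "closed_cut m u (j + 1) (a + 1)" using W_set_closed_cut[OF uW] nm1 by blast
          show "closed_cut m v (j + 1) (a + 1)" using W_set_closed_cut[OF vW] a(1) by simp
          show "(0 < a + 1) = odd (a + 1)" using a(2,4) by presburger
        qed (use kj1 x a nm in auto)
      qed
      have "rk n u i x \<le> rk n (v \<circ> brefl j (j + 2)) i x" for i x
      proof (rule rk_le_comp_brefl_of_less[OF u v pm(1,3) _ _ _ le])
        fix i x
        assume i: "j \<le> i" "i < j + 2" and x: "v (j + 2) < x" "x \<le> v j"
        have "i = j \<or> i = j + 1" using i by auto
        then have "rk n v i x = rk n v (j + 1) x"
          using x rowv(1)[of x] a(1) by (auto simp: a_def)
        moreover have "rk n u i x \<le> rk n u (j + 1) x" using i by (intro rk_mono_row) simp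
        ultimately show "rk n u i x < rk n v i x" using strict[of x] x vj by (simp add: a_def)
      qed (use j13 a nm vj in \<open>auto simp: a_def\<close>)
      then show ?thesis using c pm by blast
    qed
  qed
  then show ?thesis
    using rk_le_imp_bruhat_le[OF n1 u] B_group_comp[OF v] brefl_in_B_group unfolding n_def by metis
qed

end
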